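(* Let the ILRFPP model on $\mathbb{Z}^d$ satisfy the standing assumptions, and suppose $\frac d\gamma<\alpha<\frac{2d}{\gamma}$. For $t\ge0$ let $\mathbf{B}_t(0):=\{y\in\mathbb{Z}^d:T(0,y)\le t\}$ and $\mathbf{D}_t(0):=\sup\{\|y-z\|:y,z\in\mathbf{B}_t(0)\}\in[0,\infty]$. Then: (i) for every $\varepsilon\in(0,1)$ there is $t_\varepsilon<\infty$ with $$\mathbb{P}\big(|\mathbf{B}_{t_\varepsilon}(0)|=\infty\big)=\mathbb{P}\big(\mathbf{D}_{t_\varepsilon}(0)=\infty\big)\ge1-\varepsilon;$$ (ii) consequently the explosion time $\tau_\infty:=\inf\{t\ge0:|\mathbf{B}_t(0)|=\infty\}$ is finite almost surely.
   Context: Model (inhomogeneous long-range first-passage percolation, ILRFPP). Fix an integer $d\ge1$ and $\alpha>0$; $\|\cdot\|$ is the $\ell_1$ norm on $\mathbb{Z}^d$. The vertex weights $(V_x)_{x\in\mathbb{Z}^d}$ are i.i.d. with the law of a random variable $V$; the edge noises $\omega_{xy}=\omega_{yx}\ge0$, one for every unordered pair $\{x,y\}$ of distinct vertices of $\mathbb{Z}^d$ (all pairs are edges), are i.i.d. with the law of $\omega$, and independent of the vertex weights. The passage time of an edge is $W_{xy}:=\|x-y\|^{\alpha}\,\omega_{xy}/(V_xV_y)$. A path is a finite sequence of distinct vertices; its passage time is the sum of $W$ over its consecutive edges. $T(x,y)$ is the infimum of the passage times over all finite self-avoiding paths from $x$ to $y$ (so $T(x,x)=0$). Standing assumptions: for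 fixed $\gamma,\theta,\zeta>0$, $\mathbb{P}(0<V<\infty)=1$ and $\lim_{x\to\infty}\log\mathbb{P}(V\ge x)/\log x=-\gamma$; $\lim_{x\downarrow0}\log\mathbb{P}(\omega\le x)/\log x=\theta$ and $\mathbb{E}\,\omega^{\zeta}<\infty$. *)

theory Defs
  imports "HOL-Probability.Probability"
begin

text \<open>The lattice $\mathbb{Z}^d$ is the type \<open>int ^ 'd\<close>, with $d$ = \<open>CARD('d)\<close>.\<close>

definition l1_norm :: "int ^ 'd::finite \<Rightarrow> real" where
  "l1_norm x = (\<Sum>i\<in>UNIV. \<bar>real_of_int (x $ i)\<bar>)"

definition edges :: "(int ^ 'd::finite) set set" where
  "edges = {{x, y} | x y. x \<noteq> y}"

text \<open>
  In the following, \<open>V x\<close> is the weight of the vertex \<open>x\<close> and \<open>\<omega> {x, y}\<close> the noise of the edge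
  \<open>{x, y}\<close>, both as functions on a sample space. The values of \<open>\<omega>\<close> outside \<open>edges\<close> are irrelevant.

  In the locale, \<open>\<mu>V\<close> and \<open>\<mu>\<omega>\<close> are the laws of the generic variables $V$ and $\omega$. Joint
  independence of the family indexed by \<open>UNIV <+> edges\<close> says that the vertex weights are independent,
  the edge noises are independent, and the two families are independent of each other.
\<close>

locale ilrfpp = prob_space M + law_V: real_distribution \<mu>V + law_\<omega>: real_distribution \<mu>\<omega>
  for M :: "'w measure" and \<mu>V \<mu>\<omega> :: "real measure" +
  fixes V :: "int ^ 'd::finite \<Rightarrow> 'w \<Rightarrow> real"
    and \<omega> :: "(int ^ 'd) set \<Rightarrow> 'w \<Rightarrow> real"
    and \<alpha> :: real
  assumes alpha_pos: "\<alpha> > 0"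
    and indep: "indep_vars (\<lambda>_. borel) (case_sum V \<omega>) (UNIV <+> edges)"
    and distr_V: "\<And>x. distr M borel (V x) = \<mu>V"
    and distr_\<omega>: "\<And>e. e \<in> edges \<Longrightarrow> distr M borel (\<omega> e) = \<mu>\<omega>"
    and \<omega>_nonneg: "AE u in \<mu>\<omega>. 0 \<le> u"

text \<open>
  Here \<open>ln 0 = 0\<close> replaces $\log 0 = -\infty$. This is harmless: the probabilities below are
  monotone in \<open>x\<close>, so if one of them vanished, the corresponding quotient would eventually be
  \<open>0\<close> and could not converge to the nonzero limit.
\<close>

locale ilrfpp_standing = ilrfpp M \<mu>V \<mu>\<omega> V \<omega> \<alpha>
  for M :: "'w measure" and \<mu>V \<mu>\<omega> :: "real measure"
    and V :: "int ^ 'd::finite \<Rightarrow> 'w \<Rightarrow> real" and \<omega> :: "(int ^ 'd) set \<Rightarrow> 'w \<Rightarrow> real"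
    and \<alpha> :: real +
  fixes \<gamma> \<theta> \<zeta> :: real
  assumes gamma_pos: "\<gamma> > 0" and theta_pos: "\<theta> > 0" and zeta_pos: "\<zeta> > 0"
    and V_pos: "AE v in \<mu>V. 0 < v"
    and V_tail: "((\<lambda>x. ln (measure \<mu>V {x..}) / ln x) \<longlongrightarrow> - \<gamma>) at_top"
    and \<omega>_tail: "((\<lambda>x. ln (measure \<mu>\<omega> {..x}) / ln x) \<longlongrightarrow> \<theta>) (at_right 0)"
    and \<omega>_moment: "integrable \<mu>\<omega> (\<lambda>u. u powr \<zeta>)"

definition edge_time ::
  "real \<Rightarrow> (int ^ 'd::finite \<Rightarrow> 'w \<Rightarrow> real) \<Rightarrow> ((int ^ 'd) set \<Rightarrow> 'w \<Rightarrow> real) \<Rightarrow>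
    int ^ 'd \<Rightarrow> int ^ 'd \<Rightarrow> 'w \<Rightarrow> real" where
  "edge_time \<alpha> V \<omega> x y w = l1_norm (x - y) powr \<alpha> * \<omega> {x, y} w / (V x w * V y w)"

definition paths :: "int ^ 'd::finite \<Rightarrow> int ^ 'd \<Rightarrow> (int ^ 'd) list set" where
  "paths x y = {p. p \<noteq> [] \<and> distinct p \<and> hd p = x \<and> last p = y}"

definition path_time ::
  "real \<Rightarrow> (int ^ 'd::finite \<Rightarrow> 'w \<Rightarrow> real) \<Rightarrow> ((int ^ 'd) set \<Rightarrow> 'w \<Rightarrow> real) \<Rightarrow>
    (int ^ 'd) list \<Rightarrow> 'w \<Rightarrow> real" where
  "path_time \<alpha> V \<omega> p w = (\<Sum>i<length p - 1. edge_time \<alpha> V \<omega> (p ! i) (p ! Suc i) w)"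

definition passage_time ::
  "real \<Rightarrow> (int ^ 'd::finite \<Rightarrow> 'w \<Rightarrow> real) \<Rightarrow> ((int ^ 'd) set \<Rightarrow> 'w \<Rightarrow> real) \<Rightarrow>
    int ^ 'd \<Rightarrow> int ^ 'd \<Rightarrow> 'w \<Rightarrow> ereal" where
  "passage_time \<alpha> V \<omega> x y w = (INF p\<in>paths x y. ereal (path_time \<alpha> V \<omega> p w))"

definition fpp_ball ::
  "real \<Rightarrow> (int ^ 'd::finite \<Rightarrow> 'w \<Rightarrow> real) \<Rightarrow> ((int ^ 'd) set \<Rightarrow> 'w \<Rightarrow> real) \<Rightarrow>
    real \<Rightarrow> int ^ 'd \<Rightarrow> 'w \<Rightarrow> (int ^ 'd) set" where
  "fpp_ball \<alpha> V \<omega> t x w = {y. passage_time \<alpha> V \<omega> x y w \<le> ereal t}"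

definition fpp_diam ::
  "real \<Rightarrow> (int ^ 'd::finite \<Rightarrow> 'w \<Rightarrow> real) \<Rightarrow> ((int ^ 'd) set \<Rightarrow> 'w \<Rightarrow> real) \<Rightarrow>
    real \<Rightarrow> int ^ 'd \<Rightarrow> 'w \<Rightarrow> ereal" where
  "fpp_diam \<alpha> V \<omega> t x w =
    (SUP (y, z)\<in>fpp_ball \<alpha> V \<omega> t x w \<times> fpp_ball \<alpha> V \<omega> t x w. ereal (l1_norm (y - z)))"

text \<open>The infimum of the empty set is \<open>\<infinity>\<close>, i.e. no explosion.\<close>

definition explosion_time ::
  "real \<Rightarrow> (int ^ 'd::finite \<Rightarrow> 'w \<Rightarrow> real) \<Rightarrow> ((int ^ 'd) set \<Rightarrow> 'w \<Rightarrow> real) \<Rightarrow>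
    'w \<Rightarrow> ereal" where
  "explosion_time \<alpha> V \<omega> w = (INF t\<in>{t. 0 \<le> t \<and> infinite (fpp_ball \<alpha> V \<omega> t 0 w)}. ereal t)"

end

theory Submission
  imports Defs "HOL-Real_Asymp.Real_Asymp"
begin

text \<open>
  Explosion happens along a single chain of hubs, that is, vertices of exceptionally large weight,
  with one hub in each of the dyadic boxes $[2^k, 2^{k+1})^d$. Fix $b$ with
  $\alpha/2 < b < d/\gamma$ and call a vertex of the $k$-th box a hub if its weight is at least
  $2^{bk}$. An edge between a hub of box $k$ and a hub of box $k+1$ has passage time at most a
  constant times $2^{-2(b - \alpha/2)k}\,\omega$, which is summable in $k$ as long as
  $\omega \le 2^{(b - \alpha/2)k}$ (\<open>edge_time_hubs_le\<close>). If this holds from some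
  scale on, then the path that jumps from the origin to the first hub and then follows the chain
  reaches infinitely many vertices in bounded time (\<open>infinite_fpp_ball_chain\<close>).

  It remains to see that, almost surely, a hub is missing or a noise is too large at only finitely
  many scales. Let $p_k = \mathbb{P}(V \ge 2^{bk})$. The tail of $V$ gives $p_k \ge 2^{-ck}$
  eventually for some $c < d$, so that box $k$, which has $2^{dk}$ vertices, contains a
  deterministic candidate set $S_k$ of about $k/p_k$ vertices (\<open>ex_candidate_sets\<close>). With
  this size both error probabilities are summable:
  \<^item> $S_k$ contains no hub with probability at most $(1-p_k)^{|S_k|} \le e^{-k}$
    (\<open>prob_no_hub\<close>);
  \<^item> the expected number of hub pairs in $S_k \times S_{k+1}$ is $O(k^2)$, and the edge
    of each pair has, independently, a noise above $2^{(b - \alpha/2)k}$ with a probability that is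
    exponentially small in $k$ by Markov's inequality (\<open>prob_bad_edges\<close>,
    \<open>noise_tail_le\<close>).

  Restricting to $S_k$ makes a union bound over all pairs affordable. Hence the hubs of the chain
  need not be picked by a random rule, whose independence of the noises would have to be argued.

  The Borel--Cantelli lemma now yields, almost surely, an infinite ball of finite radius. The
  quantitative statement follows by continuity from below in the radius, and the event that the
  diameter is infinite is the same event, because $\ell_1$ balls of $\mathbb{Z}^d$ are finite.
\<close>

section \<open>Geometry of the lattice\<close>

lemma bij_betw_vec_nth_PiE:
  "bij_betw vec_nth {x :: 'a ^ 'n::finite. \<forall>i. x $ i \<in> A i} (Pi\<^sub>E UNIV A)"
  by (rule bij_betw_byWitness[where f' = vec_lambda]) (auto simp: PiE_def)

lemma finite_vec_box:
  fixes A :: "'n::finite \<Rightarrow> 'a set"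
  assumes "\<And>i. finite (A i)"
  shows "finite {x :: 'a ^ 'n. \<forall>i. x $ i \<in> A i}"
  using bij_betw_finite[OF bij_betw_vec_nth_PiE[of A]] assms by (simp add: finite_PiE)

lemma card_vec_box:
  fixes A :: "'n::finite \<Rightarrow> 'a set"
  shows "card {x :: 'a ^ 'n. \<forall>i. x $ i \<in> A i} = (\<Prod>i\<in>UNIV. card (A i))"
  using bij_betw_same_card[OF bij_betw_vec_nth_PiE[of A]] by (simp add: card_PiE)

lemma l1_norm_nonneg: "0 \<le> l1_norm x"
  unfolding l1_norm_def by (simp add: sum_nonneg)

lemma l1_norm_triangle: "l1_norm x \<le> l1_norm (x - y) + l1_norm y"
  unfolding l1_norm_def sum.distrib[symmetric] by (intro sum_mono) auto

lemma finite_l1_cball: "finite {x :: int ^ 'd::finite. l1_norm x \<le> r}"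
proof (rule finite_subset)
  show "finite {x :: int ^ 'd. \<forall>i. x $ i \<in> {- \<lceil>r\<rceil>..\<lceil>r\<rceil>}}"
    by (rule finite_vec_box) simp
  show "{x :: int ^ 'd. l1_norm x \<le> r} \<subseteq> {x. \<forall>i. x $ i \<in> {- \<lceil>r\<rceil>..\<lceil>r\<rceil>}}"
  proof clarify
    fix x :: "int ^ 'd" and i
    assume "l1_norm x \<le> r"
    moreover have "\<bar>real_of_int (x $ i)\<bar> \<le> l1_norm x"
      unfolding l1_norm_def by (rule member_le_sum) auto
    ultimately show "x $ i \<in> {- \<lceil>r\<rceil>..\<lceil>r\<rceil>}"
      by simp linarith
  qed
qed

lemma infinite_l1_diam_iff:
  fixes B :: "(int ^ 'd::finite) set"
  shows "(SUP (y, z)\<in>B \<times> B. ereal (l1_norm (y - z))) = \<infinity> \<longleftrightarrow> infinite B"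
proof
  assume diam: "(SUP (y, z)\<in>B \<times> B. ereal (l1_norm (y - z))) = \<infinity>"
  show "infinite B"
  proof
    assume "finite B"
    then have fin: "finite ((\<lambda>(y, z). l1_norm (y - z)) ` (B \<times> B))"
      by simp
    have "(SUP (y, z)\<in>B \<times> B. ereal (l1_norm (y - z)))
        \<le> ereal (Max ((\<lambda>(y, z). l1_norm (y - z)) ` (B \<times> B)))"
      by (rule SUP_least) (auto intro!: Max_ge[OF fin])
    with diam show False by simp
  qed
next
  assume inf: "infinite B"
  then obtain y where y: "y \<in> B"
    using infinite_imp_nonempty by blast
  show "(SUP (y, z)\<in>B \<times> B. ereal (l1_norm (y - z))) = \<infinity>"
  proof (rule SUP_PInfty)
    fix n :: nat
    have "\<not> B \<subseteq> {x. l1_norm x \<le> real n + l1_norm y}"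
      using inf finite_l1_cball finite_subset by blast
    then obtain x where x: "x \<in> B" "l1_norm x > real n + l1_norm y" by force
    then have "real n \<le> l1_norm (x - y)"
      using l1_norm_triangle[of x y] by linarith
    then show "\<exists>p\<in>B \<times> B. ereal (real n) \<le> (case p of (y, z) \<Rightarrow> ereal (l1_norm (y - z)))"
      using x y by (intro bexI[of _ "(x, y)"]) auto
  qed
qed

text \<open>
  The boxes lie in the positive orthant so that they are disjoint from each other and from the
  origin, while their side lengths and the distances between neighbours are comparable to $2^k$.
\<close>

definition dyadic_box :: "nat \<Rightarrow> (int ^ 'd::finite) set" where
  "dyadic_box k = {x. \<forall>i. x $ i \<in> {2 ^ k..<2 ^ Suc k}}"

lemma finite_dyadic_box: "finite (dyadic_box k)"
  unfolding dyadic_box_def by (rule finite_vec_box) simp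

lemma card_dyadic_box: "card (dyadic_box k :: (int ^ 'd::finite) set) = 2 ^ (k * CARD('d))"
  unfolding dyadic_box_def card_vec_box by (simp add: power_mult nat_power_eq)

lemma zero_notin_dyadic_box: "0 \<notin> dyadic_box k"
  by (auto simp: dyadic_box_def)

lemma dyadic_box_inj:
  assumes "x \<in> dyadic_box j" "x \<in> dyadic_box k"
  shows "j = k"
proof -
  have le: "m \<le> n" if "x \<in> dyadic_box m" "x \<in> dyadic_box n" for m n
  proof -
    have "(2 :: int) ^ m \<le> x $ undefined" "x $ undefined < 2 ^ Suc n"
      using that unfolding dyadic_box_def by auto
    then have "(2 :: int) ^ m < 2 ^ Suc n" by (rule le_less_trans)
    then show ?thesis by (simp del: power_Suc)
  qed
  show ?thesis using le[OF assms] le[OF assms(2,1)] by simp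
qed

lemma l1_dist_dyadic_box:
  fixes x y :: "int ^ 'd::finite"
  assumes "x \<in> dyadic_box k" "y \<in> dyadic_box (Suc k)"
  shows "l1_norm (x - y) \<le> 4 * CARD('d) * 2 ^ k"
proof -
  have "l1_norm (x - y) \<le> (\<Sum>i\<in>(UNIV :: 'd set). 4 * 2 ^ k)"
    unfolding l1_norm_def
  proof (rule sum_mono)
    fix i :: 'd
    have "x $ i \<in> {2 ^ k..<2 ^ Suc k}" "y $ i \<in> {2 ^ Suc k..<2 ^ Suc (Suc k)}"
      using assms by (auto simp: dyadic_box_def)
    then have "\<bar>x $ i - y $ i\<bar> \<le> 4 * 2 ^ k"
      by auto
    then have "real_of_int \<bar>x $ i - y $ i\<bar> \<le> real_of_int (4 * 2 ^ k)"
      by (simp only: of_int_le_iff)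
    then show "\<bar>real_of_int ((x - y) $ i)\<bar> \<le> 4 * 2 ^ k"
      by simp
  qed
  then show ?thesis by simp
qed

section \<open>Chains of vertices with summable passage times\<close>

lemma fpp_ball_mono: "s \<le> t \<Longrightarrow> fpp_ball \<alpha> V \<omega> s x w \<subseteq> fpp_ball \<alpha> V \<omega> t x w"
  unfolding fpp_ball_def by (auto intro: order_trans)

text \<open>
  The initial segments of the chain are self-avoiding paths with uniformly bounded passage times.
  The jump from the starting point to the chain is a single edge and so adds a finite amount.
\<close>

lemma infinite_fpp_ball_chain:
  fixes \<xi> :: "nat \<Rightarrow> int ^ 'd::finite"
  assumes inj: "inj \<xi>"
    and summable: "summable f"
    and step: "\<And>n. edge_time \<alpha> V \<omega> (\<xi> (Suc n)) (\<xi> (Suc (Suc n))) w \<le> f n"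
    and nonneg: "\<And>n. 0 \<le> f n"
  shows "\<exists>t\<ge>0. infinite (fpp_ball \<alpha> V \<omega> t (\<xi> 0) w)"
proof -
  define c where "c = \<bar>edge_time \<alpha> V \<omega> (\<xi> 0) (\<xi> 1) w\<bar>"
  define t where "t = c + suminf f"
  have "\<xi> (Suc n) \<in> fpp_ball \<alpha> V \<omega> t (\<xi> 0) w" for n
  proof -
    define p where "p = map \<xi> [0..<Suc (Suc n)]"
    have p: "p \<in> paths (\<xi> 0) (\<xi> (Suc n))"
      using inj_on_subset[OF inj subset_UNIV] unfolding p_def paths_def
      by (simp add: distinct_map hd_map last_map del: upt_Suc)
    have "path_time \<alpha> V \<omega> p w = (\<Sum>i<Suc n. edge_time \<alpha> V \<omega> (\<xi> i) (\<xi> (Suc i)) w)"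
      unfolding path_time_def p_def by (intro sum.cong) (auto simp del: upt_Suc)
    also have "\<dots> = edge_time \<alpha> V \<omega> (\<xi> 0) (\<xi> 1) w
        + (\<Sum>i<n. edge_time \<alpha> V \<omega> (\<xi> (Suc i)) (\<xi> (Suc (Suc i))) w)"
      by (subst sum.lessThan_Suc_shift) simp
    also have "\<dots> \<le> c + (\<Sum>i<n. f i)"
      unfolding c_def by (intro add_mono sum_mono step) auto
    also have "\<dots> \<le> t"
      unfolding t_def by (intro add_left_mono sum_le_suminf summable nonneg) auto
    finally have "path_time \<alpha> V \<omega> p w \<le> t" .
    then have "passage_time \<alpha> V \<omega> (\<xi> 0) (\<xi> (Suc n)) w \<le> ereal t"
      unfolding passage_time_def by (intro INF_lower2[OF p]) simp
    then show ?thesis by (simp add: fpp_ball_def)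
  qed
  then have sub: "range (\<lambda>n. \<xi> (Suc n)) \<subseteq> fpp_ball \<alpha> V \<omega> t (\<xi> 0) w"
    by auto
  have "infinite (range (\<lambda>n. \<xi> (Suc n)))"
    using inj by (intro range_inj_infinite) (auto simp: inj_def)
  then have "infinite (fpp_ball \<alpha> V \<omega> t (\<xi> 0) w)"
    using sub finite_subset by blast
  moreover have "0 \<le> t"
    unfolding t_def c_def using suminf_nonneg[OF summable nonneg] by simp
  ultimately show ?thesis by blast
qed

section \<open>Measurability\<close>

context ilrfpp
begin

lemma V_measurable [measurable]: "V x \<in> borel_measurable M"
  using indep unfolding indep_vars_def2 by (auto dest!: bspec[of _ _ "Inl x"])

lemma \<omega>_measurable: "e \<in> edges \<Longrightarrow> \<omega> e \<in> borel_measurable M"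
  using indep unfolding indep_vars_def2 by (auto dest!: bspec[of _ _ "Inr e"])

lemma edge_time_measurable:
  assumes "x \<noteq> y"
  shows "edge_time \<alpha> V \<omega> x y \<in> borel_measurable M"
proof -
  have [measurable]: "\<omega> {x, y} \<in> borel_measurable M"
    using assms by (intro \<omega>_measurable) (auto simp: edges_def)
  show ?thesis unfolding edge_time_def by measurable
qed

lemma passage_time_measurable: "passage_time \<alpha> V \<omega> x y \<in> borel_measurable M"
proof -
  have "(\<lambda>w. ereal (path_time \<alpha> V \<omega> p w)) \<in> borel_measurable M" if "p \<in> paths x y" for p
  proof -
    have "edge_time \<alpha> V \<omega> (p ! i) (p ! Suc i) \<in> borel_measurable M" if "i < length p - 1" for i
      using that \<open>p \<in> paths x y\<close>
      by (intro edge_time_measurable) (auto simp: paths_def nth_eq_iff_index_eq)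
    then show ?thesis
      unfolding path_time_def by (intro borel_measurable_ereal borel_measurable_sum) auto
  qed
  then show ?thesis
    unfolding passage_time_def by (intro borel_measurable_INF countableI_type) auto
qed

lemma sets_infinite_fpp_ball:
  "{w \<in> space M. infinite (fpp_ball \<alpha> V \<omega> t x w)} \<in> sets M"
proof -
  note passage_time_measurable[measurable]
  \<comment> \<open>Finite sets are enumerated by lists, of which there are only countably many.\<close>
  have "infinite (fpp_ball \<alpha> V \<omega> t x w)
      \<longleftrightarrow> (\<forall>ys. \<exists>y. y \<notin> set ys \<and> passage_time \<alpha> V \<omega> x y w \<le> ereal t)" for w
  proof -
    have "infinite B \<longleftrightarrow> (\<forall>ys. \<exists>y. y \<notin> set ys \<and> y \<in> B)" for B :: "(int ^ 'd) set"
      by (metis List.finite_set finite_list finite_subset subsetI)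
    then show ?thesis by (simp add: fpp_ball_def)
  qed
  then show ?thesis by simp
qed

end

section \<open>Probability estimates for hubs\<close>

context ilrfpp
begin

lemma prob_V:
  assumes [measurable]: "A \<in> sets borel"
  shows "prob (V x -` A \<inter> space M) = measure \<mu>V A"
  unfolding distr_V[of x, symmetric] by (simp add: measure_distr)

lemma prob_\<omega>:
  assumes "e \<in> edges" and [measurable]: "A \<in> sets borel"
  shows "prob (\<omega> e -` A \<inter> space M) = measure \<mu>\<omega> A"
  unfolding distr_\<omega>[OF assms(1), symmetric] using \<omega>_measurable[OF assms(1)]
  by (simp add: measure_distr)

lemma prob_no_hub:
  assumes "finite S"
  shows "prob {w \<in> space M. \<forall>x\<in>S. V x w < h} \<le> exp (- (card S * measure \<mu>V {h..}))"
proof (cases "S = {}")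
  case False
  have "{w \<in> space M. \<forall>x\<in>S. V x w < h}
      = (\<Inter>i\<in>Inl ` S. case_sum V \<omega> i -` {..<h} \<inter> space M)"
    using False by auto
  then have "prob {w \<in> space M. \<forall>x\<in>S. V x w < h}
      = (\<Prod>i\<in>Inl ` S. prob (case_sum V \<omega> i -` {..<h} \<inter> space M))"
    using indep_varsD[OF indep, of "Inl ` S" "\<lambda>_. {..<h}"] False assms by auto
  also have "\<dots> = (\<Prod>x\<in>S. measure \<mu>V {..<h})"
    by (subst prod.reindex) (auto simp: prob_V)
  also have "measure \<mu>V {..<h} = 1 - measure \<mu>V {h..}"
  proof -
    have "{..<h} = space \<mu>V - {h..}" by auto
    then show ?thesis using law_V.prob_compl[of "{h..}"] by simp
  qed
  also have "(\<Prod>x\<in>S. 1 - measure \<mu>V {h..}) \<le> (\<Prod>x\<in>S. exp (- measure \<mu>V {h..}))"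
    using exp_ge_add_one_self[of "- measure \<mu>V {h..}"] by (intro prod_mono) auto
  also have "\<dots> = exp (- (card S * measure \<mu>V {h..}))"
    by (simp add: exp_of_nat_mult[symmetric])
  finally show ?thesis .
qed simp

lemma prob_bad_edge:
  assumes "x \<noteq> y"
  shows "prob {w \<in> space M. h \<le> V x w \<and> h' \<le> V y w \<and> u < \<omega> {x, y} w}
    = measure \<mu>V {h..} * measure \<mu>V {h'..} * measure \<mu>\<omega> {u<..}"
proof -
  have e: "{x, y} \<in> edges" using assms by (auto simp: edges_def)
  define A where
    "A = case_sum (\<lambda>z. if z = x then {h..} else {h'..}) (\<lambda>_ :: (int ^ 'd) set. {u<..} :: real set)"
  let ?J = "{Inl x, Inl y, Inr {x, y}} :: ((int ^ 'd) + (int ^ 'd) set) set"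
  have "prob (\<Inter>i\<in>?J. case_sum V \<omega> i -` A i \<inter> space M)
      = (\<Prod>i\<in>?J. prob (case_sum V \<omega> i -` A i \<inter> space M))"
    using e by (intro indep_varsD[OF indep]) (auto simp: A_def)
  also have "(\<Inter>i\<in>?J. case_sum V \<omega> i -` A i \<inter> space M)
      = {w \<in> space M. h \<le> V x w \<and> h' \<le> V y w \<and> u < \<omega> {x, y} w}"
    using assms by (auto simp: A_def)
  also have "(\<Prod>i\<in>?J. prob (case_sum V \<omega> i -` A i \<inter> space M))
      = measure \<mu>V {h..} * measure \<mu>V {h'..} * measure \<mu>\<omega> {u<..}"
    using assms e by (simp add: A_def prob_V prob_\<omega>)
  finally show ?thesis .
qed

lemma sets_bad_edge:
  assumes "x \<noteq> y"
  shows "{w \<in> space M. h \<le> V x w \<and> h' \<le> V y w \<and> u < \<omega> {x, y} w} \<in> sets M"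
proof -
  have [measurable]: "\<omega> {x, y} \<in> borel_measurable M"
    using assms by (intro \<omega>_measurable) (auto simp: edges_def)
  show ?thesis by measurable
qed

text \<open>
  The bound is the product of the expected numbers of hubs in the two sets and the probability of a
  large noise: disjointness of the sets makes the two weights and the noise independent for every
  pair.
\<close>

lemma prob_bad_edges:
  assumes "finite S" "finite S'" "S \<inter> S' = {}"
  shows "prob {w \<in> space M. \<exists>x\<in>S. \<exists>y\<in>S'. h \<le> V x w \<and> h' \<le> V y w \<and> u < \<omega> {x, y} w}
    \<le> (card S * measure \<mu>V {h..}) * (card S' * measure \<mu>V {h'..}) * measure \<mu>\<omega> {u<..}"
proof -
  let ?E = "\<lambda>(x, y). {w \<in> space M. h \<le> V x w \<and> h' \<le> V y w \<and> u < \<omega> {x, y} w}"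
  have "{w \<in> space M. \<exists>x\<in>S. \<exists>y\<in>S'. h \<le> V x w \<and> h' \<le> V y w \<and> u < \<omega> {x, y} w}
      = (\<Union>p\<in>S \<times> S'. ?E p)"
    by auto
  then have "prob {w \<in> space M. \<exists>x\<in>S. \<exists>y\<in>S'. h \<le> V x w \<and> h' \<le> V y w \<and> u < \<omega> {x, y} w}
      \<le> (\<Sum>p\<in>S \<times> S'. prob (?E p))"
    using assms by (auto intro!: finite_measure_subadditive_finite sets_bad_edge)
  also have "\<dots> = (\<Sum>p\<in>S \<times> S'. measure \<mu>V {h..} * measure \<mu>V {h'..} * measure \<mu>\<omega> {u<..})"
    using assms by (intro sum.cong) (auto intro!: prob_bad_edge)
  finally show ?thesis by (simp add: card_cartesian_product mult_ac)
qed

end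

section \<open>Choice of the hubs\<close>

lemma eventually_powr_le_of_log_tail:
  fixes p :: "real \<Rightarrow> real"
  assumes lim: "((\<lambda>x. ln (p x) / ln x) \<longlongrightarrow> - \<gamma>) at_top"
    and "0 < \<gamma>" "\<gamma> < c" and nonneg: "\<And>x. 0 \<le> p x"
  shows "\<forall>\<^sub>F x in at_top. x powr (- c) \<le> p x"
proof -
  have "\<forall>\<^sub>F x in at_top. ln (p x) / ln x < 0" "\<forall>\<^sub>F x in at_top. - c < ln (p x) / ln x"
    using order_tendstoD[OF lim] \<open>0 < \<gamma>\<close> \<open>\<gamma> < c\<close> by auto
  then show ?thesis
    using eventually_gt_at_top[of 1]
  proof eventually_elim
    case (elim x)
    \<comment> \<open>A vanishing \<open>p x\<close> would give the quotient \<open>0\<close>, because \<open>ln 0 = 0\<close>.\<close>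
    then have "ln (p x) \<noteq> 0" by auto
    then have pos: "0 < p x"
      using nonneg[of x] by (metis ln_0 order_le_less)
    have "- c * ln x < ln (p x)"
      using elim by (simp add: field_simps)
    then have "exp (- c * ln x) \<le> exp (ln (p x))" by simp
    then show ?case using elim pos by (simp add: powr_def)
  qed
qed

text \<open>
  About $k/p_k$ vertices are taken from the $k$-th box. This is enough for the expected number of
  hubs among them to grow linearly, and no faster. The condition $c < d$ is what makes the box large
  enough.
\<close>

lemma ex_candidate_sets:
  fixes p :: "nat \<Rightarrow> real"
  assumes p: "\<And>k. 0 \<le> p k" "\<And>k. p k \<le> 1"
    and lower: "\<forall>\<^sub>F k in sequentially. 2 powr (- c * real k) \<le> p k"
    and c: "c < real CARD('d::finite)"
  obtains S :: "nat \<Rightarrow> (int ^ 'd) set"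
  where "\<And>k. S k \<subseteq> dyadic_box k" "\<And>k. real (card (S k)) * p k \<le> real k + 1"
    "\<forall>\<^sub>F k in sequentially. real k \<le> real (card (S k)) * p k"
proof -
  \<comment> \<open>The minimum with the size of the box matters for finitely many \<open>k\<close> only.\<close>
  define n where "n k = min (nat \<lceil>real k / p k\<rceil>) (2 ^ (k * CARD('d)))" for k
  have "\<exists>T \<subseteq> dyadic_box k :: (int ^ 'd) set. card T = n k" for k
    by (rule obtain_subset_with_card_n[of "n k" "dyadic_box k"])
      (auto simp: card_dyadic_box n_def)
  then obtain S :: "nat \<Rightarrow> (int ^ 'd) set"
    where S: "\<And>k. S k \<subseteq> dyadic_box k" "\<And>k. card (S k) = n k"
    by metis
  have "real (n k) * p k \<le> real k + 1" for k
  proof (cases "p k = 0")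
    case False
    then have pos: "0 < p k" using p(1)[of k] by simp
    then have "0 \<le> real k / p k" by simp
    then have "real (n k) \<le> real k / p k + 1" unfolding n_def by linarith
    then have "real (n k) * p k \<le> (real k / p k + 1) * p k"
      using pos by (intro mult_right_mono) auto
    also have "\<dots> = real k + p k" using pos by (simp add: field_simps)
    finally show ?thesis using p(2)[of k] by linarith
  qed simp
  moreover have "\<forall>\<^sub>F k in sequentially. real k \<le> real (n k) * p k"
  proof -
    define e where "e = real CARD('d) - c"
    have e: "0 < e" using c by (simp add: e_def)
    have "\<forall>\<^sub>F k in sequentially. real k * 2 powr (- e * real k) \<le> 1 / 2"
      using e by real_asymp
    moreover have "\<forall>\<^sub>F k in sequentially. 2 powr (- real CARD('d) * real k) \<le> 1 / 2"
      using zero_less_card_finite[where 'a = 'd] by real_asymp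
    ultimately have "\<forall>\<^sub>F k in sequentially.
        real k * 2 powr (c * real k) + 1 \<le> 2 powr (real CARD('d) * real k)"
    proof eventually_elim
      case (elim k)
      then have "2 powr (real CARD('d) * real k)
            * (real k * 2 powr (- e * real k) + 2 powr (- real CARD('d) * real k))
          \<le> 2 powr (real CARD('d) * real k) * 1"
        by (intro mult_left_mono) auto
      moreover have "real k * 2 powr (c * real k) + 1 = 2 powr (real CARD('d) * real k)
            * (real k * 2 powr (- e * real k) + 2 powr (- real CARD('d) * real k))"
        by (simp add: e_def distrib_left mult.left_commute[of _ "real k"]
            powr_add[symmetric] algebra_simps)
      ultimately show ?case by simp
    qed
    with lower show ?thesis
    proof eventually_elim
      case (elim k)
      have pos: "0 < p k" by (rule less_le_trans[OF _ elim(1)]) simp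
      have "real k / p k \<le> real k / 2 powr (- c * real k)"
        using elim pos by (intro divide_left_mono) auto
      also have "\<dots> = real k * 2 powr (c * real k)"
        by (simp add: powr_minus divide_simps)
      finally have "real k / p k + 1 \<le> 2 powr (real CARD('d) * real k)"
        using elim by linarith
      also have "\<dots> = real (2 ^ (k * CARD('d)))"
        by (simp add: powr_realpow[symmetric] mult.commute)
      finally have "real k / p k \<le> real (n k)"
        unfolding n_def by linarith
      then show ?case using pos by (simp add: field_simps)
    qed
  qed
  ultimately show thesis using that[of S] S by simp
qed

text \<open>
  The distance contributes $2^{\alpha k}$ and the two weights $2^{-2bk}$. The gain
  $2^{-2(b-\alpha/2)k}$ is split evenly: one half absorbs the noise, the other half is the decay
  of the passage times.
\<close>

lemma edge_time_hubs_le: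
  fixes x y :: "int ^ 'd::finite"
  assumes "x \<in> dyadic_box k" "y \<in> dyadic_box (Suc k)"
    and "2 powr (b * real k) \<le> V x w" "2 powr (b * real (Suc k)) \<le> V y w"
    and "\<omega> {x, y} w \<le> 2 powr ((b - \<alpha> / 2) * real k)" and "0 \<le> \<alpha>" "0 \<le> b"
  shows "edge_time \<alpha> V \<omega> x y w
    \<le> (4 * CARD('d)) powr \<alpha> * 2 powr (- (b - \<alpha> / 2) * real k)"
proof -
  have Vy: "2 powr (b * real k) \<le> V y w"
    by (rule order_trans[OF _ assms(4)]) (use \<open>0 \<le> b\<close> in \<open>simp add: algebra_simps\<close>)
  have "2 powr (b * real k) * 2 powr (b * real k) \<le> V x w * V y w"
    using assms(3) Vy by (intro mult_mono order_trans[OF _ assms(3)]) auto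
  then have VV: "2 powr (2 * b * real k) \<le> V x w * V y w"
    by (simp add: powr_add[symmetric] algebra_simps)
  have "l1_norm (x - y) powr \<alpha> \<le> (4 * CARD('d) * 2 ^ k) powr \<alpha>"
    using l1_dist_dyadic_box[OF assms(1,2)] \<open>0 \<le> \<alpha>\<close> l1_norm_nonneg by (intro powr_mono2) auto
  also have "\<dots> = (4 * CARD('d)) powr \<alpha> * 2 powr (\<alpha> * real k)"
    by (simp add: powr_mult powr_powr powr_realpow[symmetric] mult.commute)
  finally have dist: "l1_norm (x - y) powr \<alpha> \<le> (4 * CARD('d)) powr \<alpha> * 2 powr (\<alpha> * real k)" .
  have pos: "0 < V x w * V y w" by (rule less_le_trans[OF _ VV]) simp
  have "edge_time \<alpha> V \<omega> x y w
      \<le> l1_norm (x - y) powr \<alpha> * 2 powr ((b - \<alpha> / 2) * real k) / (V x w * V y w)"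
    unfolding edge_time_def using assms(5) pos
    by (intro divide_right_mono mult_left_mono) auto
  also have "\<dots> \<le> (4 * CARD('d)) powr \<alpha> * 2 powr (\<alpha> * real k) * 2 powr ((b - \<alpha> / 2) * real k)
      / 2 powr (2 * b * real k)"
    using VV dist by (intro frac_le mult_right_mono) auto
  also have "\<dots> = (4 * CARD('d)) powr \<alpha>
      * 2 powr (\<alpha> * real k + (b - \<alpha> / 2) * real k - 2 * b * real k)"
    by (simp add: powr_add powr_diff)
  also have "\<alpha> * real k + (b - \<alpha> / 2) * real k - 2 * b * real k = - (b - \<alpha> / 2) * real k"
    by (simp add: algebra_simps)
  finally show ?thesis .
qed

section \<open>Explosion\<close>

context ilrfpp_standing
begin

lemma noise_tail_le:
  assumes "0 < u"
  shows "measure \<mu>\<omega> {u<..} \<le> (\<integral>v. v powr \<zeta> \<partial>\<mu>\<omega>) * u powr (- \<zeta>)"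
proof -
  have "measure \<mu>\<omega> {u<..} \<le> measure \<mu>\<omega> {v \<in> space \<mu>\<omega>. u powr \<zeta> \<le> v powr \<zeta>}"
    using assms zeta_pos by (intro law_\<omega>.finite_measure_mono) (auto intro!: powr_mono2)
  also have "\<dots> \<le> (\<integral>v. v powr \<zeta> \<partial>\<mu>\<omega>) / u powr \<zeta>"
    using \<omega>_moment assms by (intro integral_Markov_inequality_measure[where A = "{}"]) auto
  finally show ?thesis by (simp add: powr_minus divide_inverse)
qed

lemma AE_infinite_fpp_ball:
  assumes \<alpha>: "\<alpha> < 2 * real CARD('d) / \<gamma>"
  shows "AE w in M. \<exists>t\<ge>0. infinite (fpp_ball \<alpha> V \<omega> t 0 w)"
proof -
  \<comment> \<open>Above \<open>\<alpha> / 2\<close>, the weights of two hubs outweigh their distance; below \<open>d / \<gamma>\<close>, every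
    large box is likely to contain a hub.\<close>
  obtain b where b: "\<alpha> / 2 < b" "b < real CARD('d) / \<gamma>"
    using dense[of "\<alpha> / 2" "real CARD('d) / \<gamma>"] \<alpha> by fastforce
  have "0 < b" using b alpha_pos by linarith
  have "\<gamma> * b < real CARD('d)" using b gamma_pos by (simp add: field_simps)
  then obtain c where c: "\<gamma> * b < c" "c < real CARD('d)"
    using dense by blast
  define \<eta> where "\<eta> = b - \<alpha> / 2"
  have "0 < \<eta>" using b by (simp add: \<eta>_def)
  define h where "h k = 2 powr (b * real k)" for k :: nat
  define u where "u k = 2 powr (\<eta> * real k)" for k :: nat
  define p where "p k = measure \<mu>V {h k..}" for k
  have "\<forall>\<^sub>F x in at_top. x powr (- (c / b)) \<le> measure \<mu>V {x..}"
    using c \<open>0 < b\<close> gamma_pos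
    by (intro eventually_powr_le_of_log_tail[OF V_tail]) (auto simp: field_simps)
  moreover have "filterlim h at_top sequentially"
    unfolding h_def using \<open>0 < b\<close> by real_asymp
  ultimately have "\<forall>\<^sub>F k in sequentially. h k powr (- (c / b)) \<le> p k"
    unfolding p_def by (rule eventually_compose_filterlim)
  then have lower: "\<forall>\<^sub>F k in sequentially. 2 powr (- c * real k) \<le> p k"
    using \<open>0 < b\<close> by (simp add: h_def powr_powr mult.commute)
  obtain S :: "nat \<Rightarrow> (int ^ 'd) set"
    where S: "\<And>k. S k \<subseteq> dyadic_box k"
      and S_upper: "\<And>k. real (card (S k)) * p k \<le> real k + 1"
      and S_lower: "\<forall>\<^sub>F k in sequentially. real k \<le> real (card (S k)) * p k"
    using ex_candidate_sets[OF _ _ lower c(2)] unfolding p_def by auto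
  have fin: "finite (S k)" for k
    using S finite_dyadic_box finite_subset by blast
  have disj: "S k \<inter> S (Suc k) = {}" for k
    using S dyadic_box_inj by (metis disjoint_iff n_not_Suc_n subsetD)

  \<comment> \<open>The two ways in which the chain can break at scale \<open>k\<close>.\<close>
  define A where "A k = {w \<in> space M. \<forall>x\<in>S k. V x w < h k}" for k
  define B where "B k = {w \<in> space M. \<exists>x\<in>S k. \<exists>y\<in>S (Suc k).
    h k \<le> V x w \<and> h (Suc k) \<le> V y w \<and> u k < \<omega> {x, y} w}" for k
  have [measurable]: "A k \<in> sets M" for k
    unfolding A_def using fin by measurable
  have [measurable]: "B k \<in> sets M" for k
    unfolding B_def using disj
    by (intro sets.sets_Collect_finite_Ex fin sets_bad_edge) auto

  have "AE w in M. \<forall>\<^sub>F k in sequentially. w \<in> space M - A k"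
  proof (rule borel_cantelli_AE1)
    have "\<forall>\<^sub>F k in sequentially. norm (prob (A k)) \<le> exp (- 1) ^ k"
      using S_lower
    proof eventually_elim
      case (elim k)
      have "prob (A k) \<le> exp (- (card (S k) * p k))"
        unfolding A_def p_def by (rule prob_no_hub[OF fin])
      also have "\<dots> \<le> exp (- real k)" using elim by simp
      finally show ?case by (simp add: exp_of_nat_mult[symmetric])
    qed
    then show "summable (\<lambda>k. prob (A k))"
      by (rule summable_comparison_test_ev) (simp add: summable_geometric)
  qed (simp_all add: emeasure_eq_measure)
  moreover have "AE w in M. \<forall>\<^sub>F k in sequentially. w \<in> space M - B k"
  proof (rule borel_cantelli_AE1)
    define m where "m = (\<integral>v. v powr \<zeta> \<partial>\<mu>\<omega>)"
    \<comment> \<open>Half of the exponential decay of the noise tail pays for the quadratic number of pairs.\<close>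
    define s where "s = \<eta> * \<zeta> / 2"
    have "0 < s" using \<open>0 < \<eta>\<close> zeta_pos by (simp add: s_def)
    have "0 \<le> m" unfolding m_def by simp
    have "\<forall>\<^sub>F k in sequentially. (real k + 1) * (real k + 2) * 2 powr (- s * real k) \<le> 1"
      using \<open>0 < s\<close> by real_asymp
    then have "\<forall>\<^sub>F k in sequentially. norm (prob (B k)) \<le> m * (2 powr (- s)) ^ k"
    proof eventually_elim
      case (elim k)
      have "prob (B k) \<le> (card (S k) * p k) * (card (S (Suc k)) * p (Suc k)) * measure \<mu>\<omega> {u k<..}"
        unfolding B_def p_def by (rule prob_bad_edges[OF fin fin disj])
      also have "\<dots> \<le> (real k + 1) * (real k + 2) * (m * u k powr (- \<zeta>))"
        using S_upper[of k] S_upper[of "Suc k"] noise_tail_le[of "u k"]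
        by (intro mult_mono) (auto simp: m_def u_def p_def)
      also have "u k powr (- \<zeta>) = 2 powr (- s * real k) * 2 powr (- s * real k)"
        by (simp add: u_def s_def powr_powr powr_add[symmetric] algebra_simps)
      also have "(real k + 1) * (real k + 2) * (m * (2 powr (- s * real k) * 2 powr (- s * real k)))
          = ((real k + 1) * (real k + 2) * 2 powr (- s * real k)) * (m * 2 powr (- s * real k))"
        by (simp add: mult_ac)
      also have "\<dots> \<le> 1 * (m * 2 powr (- s * real k))"
        using elim \<open>0 \<le> m\<close> by (intro mult_right_mono) auto
      finally show ?case by (simp add: powr_power mult.commute)
    qed
    then show "summable (\<lambda>k. prob (B k))"
      by (rule summable_comparison_test_ev)
        (use \<open>0 < s\<close> in \<open>auto intro!: summable_mult summable_geometric simp: powr_less_one\<close>)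
  qed (simp_all add: emeasure_eq_measure)
  ultimately show ?thesis
  proof eventually_elim
    case (elim w)
    then have "\<forall>\<^sub>F k in sequentially. w \<in> space M - A k \<and> w \<in> space M - B k"
      by eventually_elim auto
    then obtain K where K: "\<And>k. K \<le> k \<Longrightarrow> w \<in> space M - A k \<and> w \<in> space M - B k"
      unfolding eventually_sequentially by auto
    then have "\<exists>x\<in>S k. h k \<le> V x w" if "K \<le> k" for k
      using that by (fastforce simp: A_def not_less)
    then obtain x where x: "\<And>k. K \<le> k \<Longrightarrow> x k \<in> S k" "\<And>k. K \<le> k \<Longrightarrow> h k \<le> V (x k) w"
      by metis
    define \<xi> where "\<xi> n = (case n of 0 \<Rightarrow> 0 | Suc m \<Rightarrow> x (K + m))" for n
    define f where "f n = (4 * CARD('d)) powr \<alpha> * 2 powr (- \<eta> * real (K + n))" for n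
    have box: "x (K + n) \<in> dyadic_box (K + n)" for n
      using x(1) S by (meson le_add1 subsetD)
    have "\<exists>t\<ge>0. infinite (fpp_ball \<alpha> V \<omega> t (\<xi> 0) w)"
    proof (rule infinite_fpp_ball_chain)
      show "inj \<xi>"
      proof (rule injI)
        fix m n assume "\<xi> m = \<xi> n"
        then show "m = n"
          using box[of "m - 1"] box[of "n - 1"] zero_notin_dyadic_box
            dyadic_box_inj[of "x (K + (m - 1))" "K + (m - 1)" "K + (n - 1)"]
          by (cases m; cases n) (auto simp: \<xi>_def)
      qed
      have "f = (\<lambda>n. (4 * CARD('d)) powr \<alpha> * 2 powr (- \<eta> * real K) * (2 powr (- \<eta>)) ^ n)"
        by (auto simp: f_def powr_power powr_add[symmetric] algebra_simps)
      then show "summable f"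
        using \<open>0 < \<eta>\<close> by (auto intro!: summable_mult summable_geometric simp: powr_less_one)
      show "0 \<le> f n" for n by (simp add: f_def)
      show "edge_time \<alpha> V \<omega> (\<xi> (Suc n)) (\<xi> (Suc (Suc n))) w \<le> f n" for n
      proof -
        let ?k = "K + n"
        have S': "x ?k \<in> S ?k" "x (Suc ?k) \<in> S (Suc ?k)"
          and h': "h ?k \<le> V (x ?k) w" "h (Suc ?k) \<le> V (x (Suc ?k)) w"
          using x by auto
        have "w \<in> space M - B ?k" using K[of ?k] by simp
        then have "\<omega> {x ?k, x (Suc ?k)} w \<le> u ?k"
          using S' h' by (force simp: B_def not_less)
        then have "edge_time \<alpha> V \<omega> (x ?k) (x (Suc ?k)) w
            \<le> (4 * CARD('d)) powr \<alpha> * 2 powr (- (b - \<alpha> / 2) * real ?k)"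
          using S S' h' alpha_pos \<open>0 < b\<close>
          by (intro edge_time_hubs_le) (auto simp: h_def u_def \<eta>_def)
        then show ?thesis by (simp add: \<xi>_def f_def \<eta>_def)
      qed
    qed
    then show ?case by (simp add: \<xi>_def)
  qed
qed

end

theorem proposition2p5:
  fixes M :: "'w measure" and \<mu>V \<mu>\<omega> :: "real measure"
    and V :: "int ^ 'd::finite \<Rightarrow> 'w \<Rightarrow> real" and \<omega> :: "(int ^ 'd) set \<Rightarrow> 'w \<Rightarrow> real"
    and \<alpha> \<gamma> \<theta> \<zeta> :: real
  assumes "ilrfpp_standing M \<mu>V \<mu>\<omega> V \<omega> \<alpha> \<gamma> \<theta> \<zeta>"
    and "real CARD('d) / \<gamma> < \<alpha>" and "\<alpha> < 2 * real CARD('d) / \<gamma>"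
  shows "(\<forall>\<epsilon>\<in>{0<..<1}. \<exists>t\<ge>0.
            measure M {w \<in> space M. infinite (fpp_ball \<alpha> V \<omega> t 0 w)} =
              measure M {w \<in> space M. fpp_diam \<alpha> V \<omega> t 0 w = \<infinity>} \<and>
            measure M {w \<in> space M. fpp_diam \<alpha> V \<omega> t 0 w = \<infinity>} \<ge> 1 - \<epsilon>)
         \<and> (AE w in M. explosion_time \<alpha> V \<omega> w < \<infinity>)"
proof (intro conjI ballI)
  interpret ilrfpp_standing M \<mu>V \<mu>\<omega> V \<omega> \<alpha> \<gamma> \<theta> \<zeta> by fact
  note AE = AE_infinite_fpp_ball[OF assms(3)]
  show "AE w in M. explosion_time \<alpha> V \<omega> w < \<infinity>"
    using AE
  proof eventually_elim
    case (elim w)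
    then obtain t where "t \<in> {t. 0 \<le> t \<and> infinite (fpp_ball \<alpha> V \<omega> t 0 w)}" by auto
    then have "explosion_time \<alpha> V \<omega> w \<le> ereal t"
      unfolding explosion_time_def by (rule INF_lower)
    then show ?case by (auto intro: le_less_trans)
  qed
  fix \<epsilon> :: real assume "\<epsilon> \<in> {0<..<1}"
  define G where "G n = {w \<in> space M. infinite (fpp_ball \<alpha> V \<omega> (real n) 0 w)}" for n :: nat
  have diam: "{w \<in> space M. fpp_diam \<alpha> V \<omega> t 0 w = \<infinity>}
      = {w \<in> space M. infinite (fpp_ball \<alpha> V \<omega> t 0 w)}" for t
    unfolding fpp_diam_def infinite_l1_diam_iff ..
  have G: "range G \<subseteq> sets M"
    unfolding G_def using sets_infinite_fpp_ball by auto
  have "incseq G"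
  proof (rule monoI)
    fix m n :: nat assume "m \<le> n"
    then show "G m \<subseteq> G n"
      unfolding G_def using finite_subset[OF fpp_ball_mono[of "real m" "real n" \<alpha> V \<omega> 0]] by auto
  qed
  have "AE w in M. w \<in> (\<Union>n. G n)"
    using AE AE_space
  proof eventually_elim
    case (elim w)
    then obtain t where t: "infinite (fpp_ball \<alpha> V \<omega> t 0 w)" by auto
    obtain n where "t \<le> real n" using real_arch_simple by blast
    with t have "infinite (fpp_ball \<alpha> V \<omega> (real n) 0 w)"
      using finite_subset[OF fpp_ball_mono[of t "real n" \<alpha> V \<omega> 0 w]] by auto
    with elim show ?case by (auto simp: G_def)
  qed
  then have "prob (\<Union>n. G n) = 1"
    using G by (intro prob_eq_1[THEN iffD2]) auto
  then have "(\<lambda>n. prob (G n)) \<longlonglongrightarrow> 1"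
    using finite_Lim_measure_incseq[OF G \<open>incseq G\<close>] by simp
  then have "\<forall>\<^sub>F n in sequentially. 1 - \<epsilon> < prob (G n)"
    using \<open>\<epsilon> \<in> {0<..<1}\<close> by (intro order_tendstoD) auto
  then obtain n where "1 - \<epsilon> < prob (G n)"
    by (auto simp: eventually_sequentially)
  then show "\<exists>t\<ge>0.
      prob {w \<in> space M. infinite (fpp_ball \<alpha> V \<omega> t 0 w)} =
        prob {w \<in> space M. fpp_diam \<alpha> V \<omega> t 0 w = \<infinity>} \<and>
      prob {w \<in> space M. fpp_diam \<alpha> V \<omega> t 0 w = \<infinity>} \<ge> 1 - \<epsilon>"
    unfolding diam by (intro exI[of _ "real n"]) (simp add: G_def)
qed

end
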